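(* Let $t$ be a term of PPC_dB (well-formed, so that $\mathcal U(t)$ is defined) and let $s$ be a term of PPC. Then $\mathcal T(\mathcal U(t))=t$ and $\mathcal U(\mathcal T(s))=_\alpha s$.
   Context: **PPC.** Fix a countably infinite set of symbols. PPC terms are $t::=x\mid\hat x\mid t\,t\mid\lambda_\theta p.s$, where $\theta$ is a list of symbols. In $\lambda_\theta p.s$, $\theta$ binds the matchables $\hat x$ ($x\in\theta$) in $p$ and the variables $x$ ($x\in\theta$) in $s$. Free variables and free matchables: $fv(x)=\{x\}$, $fv(\hat x)=\emptyset$, $fm(x)=\emptyset$, $fm(\hat x)=\{x\}$; both are unions on applications; $fv(\lambda_\theta p.s)=fv(p)\cup(fv(s)\setminus\theta)$ and $fm(\lambda_\theta p.s)=(fm(p)\setminus\theta)\cup fm(s)$. $=_\alpha$ denotes $\alpha$-equivalence. **PPC_dB.** PPC_dB terms are $t::=\mathsf v_{i,j}\mid\mathsf m_{i,j}\mid t\,t\mid\lambda_np.s$, with $i,j\ge1$ and $n\in\mathbb N$ (variable and matchable bidimensional indices, with primary index $i$ and secondary index $j$). For a set $S$ of pairs, $S-1$ subtracts $1$ from each primary index and drops the non-positive ones. Free indices: $fv(\mathsf v_{i,j})=\{(i,j)\}$ and $fm(\mathsf m_{i,j})=\{(i,j)\}$ (empty in the other two cases); both are unions on applications; $fv(\lambda_np.s)=fv(p)\cup(fv(s)-1)$ and $fm(\lambda_np.s)=(fm(p)-1)\cup fm(s)$. A term is well-formed if every free index has secondary index $1$, and for every subterm $\lambda_np.s$ all pairs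 $(1,j)\in fm(p)\cup fv(s)$ satisfy $j\le n$. Equality of PPC_dB terms is modulo permutation of the secondary indices bound by a same abstraction. **Translations.** For lists of lists of symbols $V,M$: $V_{ij}$ is the $j$-th element of the $i$-th list, $++$ is concatenation, and for a list $\theta$ of symbols $\theta++V$ means $[\theta]++V$. Forward translation $\mathcal T_{V,M}$ (defined when $fv(t)\subseteq\bigcup V$ and $fm(t)\subseteq\bigcup M$): - $\mathcal T_{V,M}(x)=\mathsf v_{i,j}$, where $i=\min\{i'\mid x\in V_{i'}\}$ and $j=\min\{j'\mid x=V_{ij'}\}$; - $\mathcal T_{V,M}(\hat x)=\mathsf m_{i,j}$, defined likewise using $M$; - homomorphic on applications; - $\mathcal T_{V,M}(\lambda_\theta p.s)=\lambda_{|\theta|}\mathcal T_{V,\theta++M}(p).\mathcal T_{\theta++V,M}(s)$. Backward translation $\mathcal U_{V,M}$ (for $V,M$ lists of lists of distinct symbols with $V_{ij}$ defined for $(i,j)\in fv(t)$ and $M_{ij}$ defined for $(i,j)\in fm(t)$): - $\mathcal U_{V,M}(\mathsf v_{i,j})=V_{ij}$ and $\mathcal U_{V,M}(\mathsf m_{i,j})=\widehat{M_{ij}}$; - homomorphic on applications; - $\mathcal U_{V,M}(\lambda_np.s)=\lambda_\theta\mathcal U_{V,\theta++M}(p).\mathcal U_{\theta++V,M}(s)$, with $\theta$ a list of $n$ fresh symbols. Fix an enumeration $x_1,x_2,\dots$ of the symbols. - $\mathcal T(s)=\mathcal T_{X,X}(s)$ with $X=[[x_1],\dots,[x_n]]$,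 where $fv(s)\cup fm(s)\subseteq\{x_1,\dots,x_n\}$. - $\mathcal U(t)=\mathcal U_{X,X}(t)$ with $X=[[x_1],\dots,[x_n]]$, where $fv(t)\cup fm(t)\subseteq\{(1,1),\dots,(n,1)\}$. *)

theory Defs
  imports "HOL-Combinatorics.Permutations"
begin

section \<open>PPC\<close>

datatype 'a ppc =
    Var 'a
  | Mat 'a
  | App "'a ppc" "'a ppc"
  | Lam "'a list" "'a ppc" "'a ppc"

primrec fv :: "'a ppc \<Rightarrow> 'a set" where
  "fv (Var x) = {x}"
| "fv (Mat x) = {}"
| "fv (App t u) = fv t \<union> fv u"
| "fv (Lam \<theta> p s) = fv p \<union> (fv s - set \<theta>)"

primrec fm :: "'a ppc \<Rightarrow> 'a set" where
  "fm (Var x) = {}"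
| "fm (Mat x) = {x}"
| "fm (App t u) = fm t \<union> fm u"
| "fm (Lam \<theta> p s) = (fm p - set \<theta>) \<union> fm s"

text \<open>All symbols of a term, bound ones and binder lists included, are
  \<open>set_ppc t\<close>.  The two renamings below act on the free variables and on the free
  matchables, respectively, and do not avoid capture; \<open>alpha\<close> only uses them with
  target symbols that do not occur in the term.\<close>

primrec ren_var :: "('a \<rightharpoonup> 'a) \<Rightarrow> 'a ppc \<Rightarrow> 'a ppc" where
  "ren_var f (Var x) = Var (case f x of None \<Rightarrow> x | Some y \<Rightarrow> y)"
| "ren_var f (Mat x) = Mat x"
| "ren_var f (App t u) = App (ren_var f t) (ren_var f u)"
| "ren_var f (Lam \<theta> p s) = Lam \<theta> (ren_var f p) (ren_var (f |` (- set \<theta>)) s)"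

primrec ren_mat :: "('a \<rightharpoonup> 'a) \<Rightarrow> 'a ppc \<Rightarrow> 'a ppc" where
  "ren_mat f (Var x) = Var x"
| "ren_mat f (Mat x) = Mat (case f x of None \<Rightarrow> x | Some y \<Rightarrow> y)"
| "ren_mat f (App t u) = App (ren_mat f t) (ren_mat f u)"
| "ren_mat f (Lam \<theta> p s) = Lam \<theta> (ren_mat (f |` (- set \<theta>)) p) (ren_mat f s)"

text \<open>Binder lists are renamed position by position; they are not permuted.  If a
  symbol is repeated in \<open>\<theta>\<close>, then \<open>map_of\<close> attributes its bound occurrences to the
  first position, which is also the position selected by the minimum in the forward
  translation.\<close>

inductive alpha :: "'a ppc \<Rightarrow> 'a ppc \<Rightarrow> bool" (infix "=\<^sub>\<alpha>" 50) where
  alpha_rename: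
    "\<lbrakk>length \<theta>' = length \<theta>; distinct \<theta>'; set \<theta>' \<inter> set_ppc (Lam \<theta> p s) = {}\<rbrakk> \<Longrightarrow>
     Lam \<theta> p s =\<^sub>\<alpha>
       Lam \<theta>' (ren_mat (map_of (zip \<theta> \<theta>')) p) (ren_var (map_of (zip \<theta> \<theta>')) s)"
| alpha_refl: "t =\<^sub>\<alpha> t"
| alpha_sym: "t =\<^sub>\<alpha> u \<Longrightarrow> u =\<^sub>\<alpha> t"
| alpha_trans: "t =\<^sub>\<alpha> u \<Longrightarrow> u =\<^sub>\<alpha> w \<Longrightarrow> t =\<^sub>\<alpha> w"
| alpha_App: "t =\<^sub>\<alpha> t' \<Longrightarrow> u =\<^sub>\<alpha> u' \<Longrightarrow> App t u =\<^sub>\<alpha> App t' u'"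
| alpha_Lam: "p =\<^sub>\<alpha> p' \<Longrightarrow> s =\<^sub>\<alpha> s' \<Longrightarrow> Lam \<theta> p s =\<^sub>\<alpha> Lam \<theta> p' s'"


section \<open>PPC with bidimensional indices\<close>

text \<open>Indices start at 1; this is enforced by \<open>pos_indices\<close>, which is part of
  \<open>wf_db\<close>.\<close>

datatype db =
    DVar nat nat
  | DMat nat nat
  | DApp db db
  | DLam nat db db

primrec pos_indices :: "db \<Rightarrow> bool" where
  "pos_indices (DVar i j) \<longleftrightarrow> 1 \<le> i \<and> 1 \<le> j"
| "pos_indices (DMat i j) \<longleftrightarrow> 1 \<le> i \<and> 1 \<le> j"
| "pos_indices (DApp t u) \<longleftrightarrow> pos_indices t \<and> pos_indices u"
| "pos_indices (DLam n p s) \<longleftrightarrow> pos_indices p \<and> pos_indices s"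

definition dec_primary :: "(nat \<times> nat) set \<Rightarrow> (nat \<times> nat) set" where
  "dec_primary S = {(i - 1, j) | i j. (i, j) \<in> S \<and> 1 < i}"

primrec dfv :: "db \<Rightarrow> (nat \<times> nat) set" where
  "dfv (DVar i j) = {(i, j)}"
| "dfv (DMat i j) = {}"
| "dfv (DApp t u) = dfv t \<union> dfv u"
| "dfv (DLam n p s) = dfv p \<union> dec_primary (dfv s)"

primrec dfm :: "db \<Rightarrow> (nat \<times> nat) set" where
  "dfm (DVar i j) = {}"
| "dfm (DMat i j) = {(i, j)}"
| "dfm (DApp t u) = dfm t \<union> dfm u"
| "dfm (DLam n p s) = dec_primary (dfm p) \<union> dfm s"

primrec subterms :: "db \<Rightarrow> db set" where
  "subterms (DVar i j) = {DVar i j}"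
| "subterms (DMat i j) = {DMat i j}"
| "subterms (DApp t u) = insert (DApp t u) (subterms t \<union> subterms u)"
| "subterms (DLam n p s) = insert (DLam n p s) (subterms p \<union> subterms s)"

definition wf_db :: "db \<Rightarrow> bool" where
  "wf_db t \<longleftrightarrow>
     pos_indices t \<and>
     (\<forall>(i, j) \<in> dfv t \<union> dfm t. j = 1) \<and>
     (\<forall>n p s. DLam n p s \<in> subterms t \<longrightarrow> (\<forall>j. (1, j) \<in> dfm p \<union> dfv s \<longrightarrow> j \<le> n))"

text \<open>\<open>perm_var k \<pi> t\<close> and \<open>perm_mat k \<pi> t\<close> apply \<open>\<pi>\<close> to the secondary indices of the
  free variables, respectively matchables, of \<open>t\<close> whose primary index, read at the
  root of \<open>t\<close>, is \<open>k\<close>.\<close>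

primrec perm_var :: "nat \<Rightarrow> (nat \<Rightarrow> nat) \<Rightarrow> db \<Rightarrow> db" where
  "perm_var k \<pi> (DVar i j) = DVar i (if i = k then \<pi> j else j)"
| "perm_var k \<pi> (DMat i j) = DMat i j"
| "perm_var k \<pi> (DApp t u) = DApp (perm_var k \<pi> t) (perm_var k \<pi> u)"
| "perm_var k \<pi> (DLam n p s) = DLam n (perm_var k \<pi> p) (perm_var (Suc k) \<pi> s)"

primrec perm_mat :: "nat \<Rightarrow> (nat \<Rightarrow> nat) \<Rightarrow> db \<Rightarrow> db" where
  "perm_mat k \<pi> (DVar i j) = DVar i j"
| "perm_mat k \<pi> (DMat i j) = DMat i (if i = k then \<pi> j else j)"
| "perm_mat k \<pi> (DApp t u) = DApp (perm_mat k \<pi> t) (perm_mat k \<pi> u)"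
| "perm_mat k \<pi> (DLam n p s) = DLam n (perm_mat (Suc k) \<pi> p) (perm_mat k \<pi> s)"

text \<open>Equality of PPC with bidimensional indices.\<close>

inductive db_eq :: "db \<Rightarrow> db \<Rightarrow> bool" (infix "=\<^sub>d" 50) where
  db_eq_perm: "\<pi> permutes {1..n} \<Longrightarrow> DLam n p s =\<^sub>d DLam n (perm_mat 1 \<pi> p) (perm_var 1 \<pi> s)"
| db_eq_refl: "t =\<^sub>d t"
| db_eq_sym: "t =\<^sub>d u \<Longrightarrow> u =\<^sub>d t"
| db_eq_trans: "t =\<^sub>d u \<Longrightarrow> u =\<^sub>d w \<Longrightarrow> t =\<^sub>d w"
| db_eq_App: "t =\<^sub>d t' \<Longrightarrow> u =\<^sub>d u' \<Longrightarrow> DApp t u =\<^sub>d DApp t' u'"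
| db_eq_Lam: "p =\<^sub>d p' \<Longrightarrow> s =\<^sub>d s' \<Longrightarrow> DLam n p s =\<^sub>d DLam n p' s'"


section \<open>Translations\<close>

definition symbols :: "'a list list \<Rightarrow> 'a set" where
  "symbols V = \<Union> (set ` set V)"

text \<open>List positions are counted from 1 in both dimensions.\<close>

definition entry_defined :: "'a list list \<Rightarrow> nat \<Rightarrow> nat \<Rightarrow> bool" where
  "entry_defined V i j \<longleftrightarrow> 1 \<le> i \<and> i \<le> length V \<and> 1 \<le> j \<and> j \<le> length (V ! (i - 1))"

definition entry :: "'a list list \<Rightarrow> nat \<Rightarrow> nat \<Rightarrow> 'a" where
  "entry V i j = V ! (i - 1) ! (j - 1)"

definition primary_index :: "'a list list \<Rightarrow> 'a \<Rightarrow> nat" where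
  "primary_index V x = (LEAST i. 1 \<le> i \<and> i \<le> length V \<and> x \<in> set (V ! (i - 1)))"

definition secondary_index :: "'a list list \<Rightarrow> 'a \<Rightarrow> nat" where
  "secondary_index V x =
     (LEAST j. entry_defined V (primary_index V x) j \<and> x = entry V (primary_index V x) j)"

text \<open>Meaningful only if \<open>fv t \<subseteq> symbols V\<close> and \<open>fm t \<subseteq> symbols M\<close>.\<close>

primrec forward :: "'a list list \<Rightarrow> 'a list list \<Rightarrow> 'a ppc \<Rightarrow> db" where
  "forward V M (Var x) = DVar (primary_index V x) (secondary_index V x)"
| "forward V M (Mat x) = DMat (primary_index M x) (secondary_index M x)"
| "forward V M (App t u) = DApp (forward V M t) (forward V M u)"
| "forward V M (Lam \<theta> p s) =
     DLam (length \<theta>) (forward V ([\<theta>] @ M) p) (forward ([\<theta>] @ V) M s)"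

text \<open>The backward translation depends on the choice of fresh symbols at each
  abstraction, so it is a relation: \<open>backward V M t u\<close> states that \<open>u\<close> is the
  translation of \<open>t\<close> for some such choices.\<close>

inductive backward :: "'a list list \<Rightarrow> 'a list list \<Rightarrow> db \<Rightarrow> 'a ppc \<Rightarrow> bool" where
  backward_Var: "entry_defined V i j \<Longrightarrow> backward V M (DVar i j) (Var (entry V i j))"
| backward_Mat: "entry_defined M i j \<Longrightarrow> backward V M (DMat i j) (Mat (entry M i j))"
| backward_App:
    "\<lbrakk>backward V M t t'; backward V M u u'\<rbrakk> \<Longrightarrow> backward V M (DApp t u) (App t' u')"
| backward_Lam:
    "\<lbrakk>length \<theta> = n; distinct \<theta>; set \<theta> \<inter> (symbols V \<union> symbols M) = {};
      backward V ([\<theta>] @ M) p p'; backward ([\<theta>] @ V) M s s'\<rbrakk> \<Longrightarrow>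
     backward V M (DLam n p s) (Lam \<theta> p' s')"

text \<open>In the following, \<open>x 1, x 2, \<dots>\<close> is the enumeration of the symbols (\<open>x 0\<close> is
  irrelevant).  The top-level translations leave open the number \<open>n\<close> of enumerated
  symbols, subject to a lower bound; being relations, they cover every admissible
  \<open>n\<close>.\<close>

definition init_list :: "(nat \<Rightarrow> 'a) \<Rightarrow> nat \<Rightarrow> 'a list list" where
  "init_list x n = map (\<lambda>i. [x i]) [1..<n + 1]"

definition translates_to_db :: "(nat \<Rightarrow> 'a) \<Rightarrow> 'a ppc \<Rightarrow> db \<Rightarrow> bool" where
  "translates_to_db x s t \<longleftrightarrow>
     (\<exists>n. fv s \<union> fm s \<subseteq> x ` {1..n} \<and> t = forward (init_list x n) (init_list x n) s)"

definition translates_to_ppc :: "(nat \<Rightarrow> 'a) \<Rightarrow> db \<Rightarrow> 'a ppc \<Rightarrow> bool" where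
  "translates_to_ppc x t s \<longleftrightarrow>
     (\<exists>n. dfv t \<union> dfm t \<subseteq> {1..n} \<times> {1} \<and> backward (init_list x n) (init_list x n) t s)"

end

theory Submission
  imports Defs
begin

text \<open>A backward translation uses distinct fresh binder lists, so no entry of the contexts is ever
  shadowed and translating forward again gives back the term on the nose.  The forward translation
  is in turn injective up to \<open>=\<^sub>\<alpha>\<close>: two abstractions with the same image are renamed to a common
  list of fresh binders, which does not change the images of their components, and one proceeds by
  induction on the size.  Hence \<open>\<U>(\<T>(s))\<close> and \<open>s\<close>, which have the same image, are
  \<open>\<alpha>\<close>-equivalent.\<close>

section \<open>Positions of symbols in contexts\<close>

definition index :: "'a list list \<Rightarrow> 'a \<Rightarrow> nat \<times> nat" where
  "index V y = (primary_index V y, secondary_index V y)"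

lemma symbols_Nil [simp]: "symbols [] = {}"
  and symbols_Cons [simp]: "symbols (\<theta> # V) = set \<theta> \<union> symbols V"
  by (auto simp: symbols_def)

lemma in_symbols_iff: "y \<in> symbols V \<longleftrightarrow> (\<exists>k < length V. y \<in> set (V ! k))"
  by (simp add: symbols_def) (metis in_set_conv_nth)

lemma entry_defined_Cons:
  "entry_defined (\<theta> # V) i j \<longleftrightarrow>
     (i = 1 \<and> 1 \<le> j \<and> j \<le> length \<theta>) \<or> (1 < i \<and> entry_defined V (i - 1) j)"
  by (cases i; cases "i - 1") (auto simp: entry_defined_def)

lemma entry_Cons:
  "entry (\<theta> # V) (Suc 0) j = \<theta> ! (j - 1)"
  "1 < i \<Longrightarrow> entry (\<theta> # V) i j = entry V (i - 1) j"
  by (auto simp: entry_def nth_Cons')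

lemma entry_in_symbols: "entry_defined V i j \<Longrightarrow> entry V i j \<in> symbols V"
  unfolding entry_defined_def entry_def symbols_def
  by (auto intro!: bexI[of _ "V ! (i - 1)"])

text \<open>A least number satisfies its predicate once some number does; the search for the
  secondary index succeeds because the primary one selects a list containing \<open>y\<close>.
  Outside \<open>symbols V\<close> both values are unspecified, whence the scope hypotheses
  below.\<close>

lemma index_of_symbol:
  assumes "y \<in> symbols V"
  shows "entry_defined V (primary_index V y) (secondary_index V y)"
    and "entry V (primary_index V y) (secondary_index V y) = y"
proof -
  from assms obtain k where k: "k < length V" "y \<in> set (V ! k)"
    by (auto simp: in_symbols_iff)
  have "1 \<le> primary_index V y \<and> primary_index V y \<le> length V
      \<and> y \<in> set (V ! (primary_index V y - 1))"
    unfolding primary_index_def by (rule LeastI[of _ "Suc k"]) (use k in auto)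
  moreover from this obtain l where
    "l < length (V ! (primary_index V y - 1))" "y = V ! (primary_index V y - 1) ! l"
    by (metis in_set_conv_nth)
  ultimately have "entry_defined V (primary_index V y) (Suc l) \<and> y = entry V (primary_index V y) (Suc l)"
    by (auto simp: entry_defined_def entry_def)
  then have "entry_defined V (primary_index V y) (secondary_index V y)
      \<and> y = entry V (primary_index V y) (secondary_index V y)"
    unfolding secondary_index_def by (rule LeastI)
  then show "entry_defined V (primary_index V y) (secondary_index V y)"
    and "entry V (primary_index V y) (secondary_index V y) = y" by auto
qed

text \<open>\<open>entry V\<close> undoes \<open>index V\<close>.\<close>

lemma index_inject:
  assumes "y \<in> symbols V" "z \<in> symbols V" "index V y = index V z"
  shows "y = z"
  using assms by (metis Pair_inject index_def index_of_symbol(2))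

lemma primary_index_Cons_in:
  assumes "y \<in> set \<theta>"
  shows "primary_index (\<theta> # V) y = 1"
  unfolding primary_index_def by (rule Least_equality) (use assms in auto)

lemma primary_index_Cons_notin:
  assumes "y \<notin> set \<theta>" "y \<in> symbols V"
  shows "primary_index (\<theta> # V) y = Suc (primary_index V y)"
proof -
  let ?P = "\<lambda>i. 1 \<le> i \<and> i \<le> length V \<and> y \<in> set (V ! (i - 1))"
  let ?Q = "\<lambda>i. 1 \<le> i \<and> i \<le> length (\<theta> # V) \<and> y \<in> set ((\<theta> # V) ! (i - 1))"
  \<comment> \<open>For \<open>i = 0\<close> both sides fail, the left one because \<open>y\<close>
    is not in \<open>\<theta>\<close>.\<close>
  have shift: "?Q (Suc i) \<longleftrightarrow> ?P i" for i
    using assms by (cases i) auto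
  from assms obtain k where k: "k < length V" "y \<in> set (V ! k)"
    by (auto simp: in_symbols_iff)
  have "(LEAST i. ?Q i) = Suc (LEAST i. ?Q (Suc i))"
    by (rule Least_Suc[of _ "Suc (Suc k)"]) (use k in auto)
  then show ?thesis
    unfolding primary_index_def by (simp only: shift)
qed

text \<open>A symbol of the head list is found there whatever follows. The right-hand side is free
  of \<open>V\<close>, so rewriting with it exchanges one tail for another.\<close>

lemma index_Cons_in:
  assumes "y \<in> set \<theta>"
  shows "index (\<theta> # V) y = index [\<theta>] y"
  using assms
  by (simp add: index_def primary_index_Cons_in secondary_index_def entry_defined_Cons entry_Cons)

lemma index_Cons_notin:
  assumes "y \<notin> set \<theta>" "y \<in> symbols V"
  shows "index (\<theta> # V) y = apfst Suc (index V y)"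
proof -
  have "1 \<le> primary_index V y"
    using index_of_symbol(1)[OF assms(2)] by (simp add: entry_defined_def)
  then show ?thesis
    using assms
    by (simp add: index_def primary_index_Cons_notin secondary_index_def entry_defined_Cons entry_Cons)
qed

text \<open>In a list without repetitions \<open>\<theta> ! k\<close> occurs only at offset
  \<open>k\<close>; offsets count from 0, hence \<open>Suc k\<close>.\<close>

lemma index_nth:
  assumes "distinct \<theta>" "k < length \<theta>"
  shows "index (\<theta> # V) (\<theta> ! k) = (1, Suc k)"
proof -
  have p: "primary_index (\<theta> # V) (\<theta> ! k) = 1"
    using assms by (simp add: primary_index_Cons_in)
  have "\<theta> ! k \<in> symbols (\<theta> # V)" using assms by simp
  note s = index_of_symbol[OF this]
  show ?thesis
    using s assms unfolding p index_def
    by (auto simp: entry_defined_Cons entry_Cons nth_eq_iff_index_eq)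
qed

section \<open>Forward after backward\<close>

lemma dec_primary_iff: "(i, j) \<in> dec_primary S \<longleftrightarrow> 1 \<le> i \<and> (Suc i, j) \<in> S"
  unfolding dec_primary_def by (cases i) force+

text \<open>Each leaf rule checks its own index, and an index free in an abstraction addresses the
  tail of the extended context.\<close>

lemma backward_defined:
  assumes "backward V M t u"
  shows "\<forall>(i, j) \<in> dfv t. entry_defined V i j" and "\<forall>(i, j) \<in> dfm t. entry_defined M i j"
  using assms
  by (induction rule: backward.induct) (fastforce simp: dec_primary_iff entry_defined_Cons)+

text \<open>Carries the invariant of \<open>forward_backward\<close> under a binder. Primary index 1
  is handled by distinctness of \<open>\<theta>\<close>; any other index names a symbol of
  \<open>V\<close>, which freshness keeps out of \<open>\<theta>\<close>, so the new list does not
  shadow it.\<close>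

lemma index_entry_Cons:
  assumes "distinct \<theta>" "set \<theta> \<inter> symbols V = {}"
    and defd: "\<forall>(i, j) \<in> S. entry_defined (\<theta> # V) i j"
    and ind: "\<forall>(i, j) \<in> dec_primary S. entry V i j \<in> symbols W \<and> index W (entry V i j) = (i, j)"
  shows "\<forall>(i, j) \<in> S. entry (\<theta> # V) i j \<in> symbols (\<theta> # W) \<and>
           index (\<theta> # W) (entry (\<theta> # V) i j) = (i, j)"
proof clarify
  fix i j assume ij: "(i, j) \<in> S"
  with defd consider "i = 1" "1 \<le> j" "j \<le> length \<theta>" | "1 < i" "entry_defined V (i - 1) j"
    by (auto simp: entry_defined_Cons)
  then show "entry (\<theta> # V) i j \<in> symbols (\<theta> # W) \<and> index (\<theta> # W) (entry (\<theta> # V) i j) = (i, j)"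
  proof cases
    case 1
    then show ?thesis
      using index_nth[OF assms(1), of "j - 1" W] by (auto simp: entry_Cons)
  next
    case 2
    then have "(i - 1, j) \<in> dec_primary S"
      using ij by (auto simp: dec_primary_iff)
    moreover have "entry V (i - 1) j \<notin> set \<theta>"
      using entry_in_symbols[OF 2(2)] assms(2) by auto
    ultimately show ?thesis
      using 2 ind by (auto simp: entry_Cons index_Cons_notin)
  qed
qed

text \<open>The way back may use contexts \<open>V'\<close> and \<open>M'\<close> other than those
  of the way out: only the positions of the symbols read off at free indices must agree. This
  absorbs the independent choices of bound at the top level.\<close>

lemma forward_backward:
  assumes "backward V M t u"
    and "\<forall>(i, j) \<in> dfv t. entry V i j \<in> symbols V' \<and> index V' (entry V i j) = (i, j)"
    and "\<forall>(i, j) \<in> dfm t. entry M i j \<in> symbols M' \<and> index M' (entry M i j) = (i, j)"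
  shows "forward V' M' u = t"
  using assms
proof (induction arbitrary: V' M' rule: backward.induct)
  case (backward_Lam \<theta> n V M p p' s s')
  have "forward V' ([\<theta>] @ M') p' = p"
  proof (rule backward_Lam.IH(1))
    show "\<forall>(i, j) \<in> dfm p. entry ([\<theta>] @ M) i j \<in> symbols ([\<theta>] @ M') \<and>
        index ([\<theta>] @ M') (entry ([\<theta>] @ M) i j) = (i, j)"
      using index_entry_Cons[of \<theta> M "dfm p" M'] backward_defined(2)[OF backward_Lam.hyps(4)]
        backward_Lam.hyps(2,3) backward_Lam.prems(2)
      by auto
  qed (use backward_Lam.prems in auto)
  moreover have "forward ([\<theta>] @ V') M' s' = s"
  proof (rule backward_Lam.IH(2))
    show "\<forall>(i, j) \<in> dfv s. entry ([\<theta>] @ V) i j \<in> symbols ([\<theta>] @ V') \<and>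
        index ([\<theta>] @ V') (entry ([\<theta>] @ V) i j) = (i, j)"
      using index_entry_Cons[of \<theta> V "dfv s" V'] backward_defined(1)[OF backward_Lam.hyps(5)]
        backward_Lam.hyps(2,3) backward_Lam.prems(1)
      by auto
  qed (use backward_Lam.prems in auto)
  ultimately show ?case
    using backward_Lam.hyps(1) by simp
qed (auto simp: index_def)

text \<open>Freshness separates the entries: primary index 1 gives symbols in
  \<open>\<theta>\<close>, the others give symbols outside it. So deleting \<open>\<theta>\<close>
  amounts to dropping the bound indices.\<close>

lemma entry_Cons_image:
  assumes "\<forall>(i, j) \<in> S. entry_defined (\<theta> # V) i j" "set \<theta> \<inter> symbols V = {}"
  shows "(\<lambda>(i, j). entry (\<theta> # V) i j) ` S - set \<theta> = (\<lambda>(i, j). entry V i j) ` dec_primary S"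
proof (intro set_eqI iffI)
  fix y assume "y \<in> (\<lambda>(i, j). entry (\<theta> # V) i j) ` S - set \<theta>"
  then obtain i j where ij: "(i, j) \<in> S" "y = entry (\<theta> # V) i j" "y \<notin> set \<theta>"
    by auto
  with assms have "1 < i"
    by (auto simp: entry_defined_Cons entry_Cons)
  with ij show "y \<in> (\<lambda>(i, j). entry V i j) ` dec_primary S"
    by (intro image_eqI[of _ _ "(i - 1, j)"]) (auto simp: entry_Cons dec_primary_iff)
next
  fix y assume "y \<in> (\<lambda>(i, j). entry V i j) ` dec_primary S"
  then obtain i j where ij: "1 \<le> i" "(Suc i, j) \<in> S" "y = entry V i j"
    by (auto simp: dec_primary_iff)
  with assms(1) have "entry_defined V i j"
    by (auto simp: entry_defined_Cons)
  then have "y \<notin> set \<theta>"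
    using assms(2) entry_in_symbols ij(3) by fastforce
  with ij show "y \<in> (\<lambda>(i, j). entry (\<theta> # V) i j) ` S - set \<theta>"
    by (auto simp: entry_Cons intro!: image_eqI[of _ _ "(Suc i, j)"])
qed

lemma backward_free:
  assumes "backward V M t u"
  shows "fv u = (\<lambda>(i, j). entry V i j) ` dfv t \<and> fm u = (\<lambda>(i, j). entry M i j) ` dfm t"
  using assms
proof (induction rule: backward.induct)
  case (backward_Lam \<theta> n V M p p' s s')
  then have "set \<theta> \<inter> symbols V = {}" "set \<theta> \<inter> symbols M = {}" by auto
  then show ?case
    using entry_Cons_image[of "dfv s" \<theta> V] backward_defined(1)[OF backward_Lam.hyps(5)]
      entry_Cons_image[of "dfm p" \<theta> M] backward_defined(2)[OF backward_Lam.hyps(4)]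
      backward_Lam.IH by (simp add: image_Un)
qed auto

section \<open>Existence of backward translations\<close>

lemma ex_fresh_list:
  assumes "infinite (UNIV :: 'a set)" "finite (A :: 'a set)"
  shows "\<exists>\<theta>. length \<theta> = n \<and> distinct \<theta> \<and> set \<theta> \<inter> A = {}"
proof -
  have "infinite (- A)"
    using assms by (simp add: Compl_eq_Diff_UNIV)
  then obtain B where "B \<subseteq> - A" "finite B" "card B = n"
    using infinite_arbitrarily_large by blast
  then show ?thesis
    by (metis disjoint_eq_subset_Compl distinct_card finite_distinct_list)
qed

lemma finite_symbols [simp]: "finite (symbols V)"
  by (simp add: symbols_def)

text \<open>The hereditary binder clause of \<open>wf_db\<close>. The clause on free secondary
  indices can fail under a binder, so inductions carry this one together with
  \<open>pos_indices\<close>.\<close>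

definition bounded_binders :: "db \<Rightarrow> bool" where
  "bounded_binders t \<longleftrightarrow>
     (\<forall>n p s. DLam n p s \<in> subterms t \<longrightarrow> (\<forall>j. (1, j) \<in> dfm p \<union> dfv s \<longrightarrow> j \<le> n))"

lemma bounded_binders_simps [simp]:
  "bounded_binders (DVar i j)"
  "bounded_binders (DMat i j)"
  "bounded_binders (DApp t u) \<longleftrightarrow> bounded_binders t \<and> bounded_binders u"
  "bounded_binders (DLam n p s) \<longleftrightarrow> (\<forall>j. (1, j) \<in> dfm p \<union> dfv s \<longrightarrow> j \<le> n) \<and>
     bounded_binders p \<and> bounded_binders s"
  unfolding bounded_binders_def by auto

lemma pos_indices_free:
  assumes "pos_indices t"
  shows "\<forall>(i, j) \<in> dfv t. 1 \<le> i \<and> 1 \<le> j" and "\<forall>(i, j) \<in> dfm t. 1 \<le> i \<and> 1 \<le> j"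
  using assms by (induction t) (auto simp: dec_primary_iff)

lemma entry_defined_Cons_all:
  assumes "\<forall>(i, j) \<in> S. 1 \<le> i \<and> 1 \<le> j" "\<forall>j. (1, j) \<in> S \<longrightarrow> j \<le> length \<theta>"
    and "\<forall>(i, j) \<in> dec_primary S. entry_defined V i j"
  shows "\<forall>(i, j) \<in> S. entry_defined (\<theta> # V) i j"
proof clarify
  fix i j assume ij: "(i, j) \<in> S"
  show "entry_defined (\<theta> # V) i j"
  proof (cases "i = 1")
    case True
    then show ?thesis using ij assms by (auto simp: entry_defined_Cons)
  next
    case False
    then have "1 < i" using ij assms(1) by fastforce
    moreover from this have "(i - 1, j) \<in> dec_primary S"
      using ij by (auto simp: dec_primary_iff)
    ultimately show ?thesis
      using assms(3) by (auto simp: entry_defined_Cons)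
  qed
qed

text \<open>Definedness of free indices passes to the components: an index bound by the abstraction
  fits into \<open>\<theta>\<close> by the binder bound, and the others come from outside.\<close>

lemma ex_backward:
  fixes V M :: "'a list list"
  assumes inf: "infinite (UNIV :: 'a set)"
    and "pos_indices t" "bounded_binders t"
    and "\<forall>(i, j) \<in> dfv t. entry_defined V i j" "\<forall>(i, j) \<in> dfm t. entry_defined M i j"
  shows "\<exists>u. backward V M t u"
  using assms(2-)
proof (induction t arbitrary: V M)
  case (DLam n p s)
  \<comment> \<open>Fresh for both contexts, since \<open>\<theta>\<close> extends \<open>M\<close>
    for the pattern and \<open>V\<close> for the body.\<close>
  obtain \<theta> :: "'a list" where \<theta>: "length \<theta> = n" "distinct \<theta>" "set \<theta> \<inter> (symbols V \<union> symbols M) = {}"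
    using ex_fresh_list[OF inf, of "symbols V \<union> symbols M" n] by auto
  have "\<forall>(i, j) \<in> dfm p. entry_defined (\<theta> # M) i j"
    by (rule entry_defined_Cons_all) (use DLam.prems \<theta> pos_indices_free[of p] in simp_all)
  with DLam.IH(1)[of V "\<theta> # M"] DLam.prems obtain p' where "backward V (\<theta> # M) p p'"
    by auto
  moreover have "\<forall>(i, j) \<in> dfv s. entry_defined (\<theta> # V) i j"
    by (rule entry_defined_Cons_all) (use DLam.prems \<theta> pos_indices_free[of s] in simp_all)
  with DLam.IH(2)[of "\<theta> # V" M] DLam.prems obtain s' where "backward (\<theta> # V) M s s'"
    by auto
  ultimately show ?case
    using \<theta> backward_Lam[of \<theta> n V M p p' s s'] by auto
qed (force intro: backward.intros)+

section \<open>Well-formedness of forward translations\<close>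

lemma dec_primary_index:
  assumes "A \<subseteq> set \<theta> \<union> symbols V"
  shows "dec_primary (index (\<theta> # V) ` A) \<subseteq> index V ` (A - set \<theta>)"
proof clarify
  fix i j assume "(i, j) \<in> dec_primary (index (\<theta> # V) ` A)"
  then obtain y where y: "y \<in> A" "index (\<theta> # V) y = (Suc i, j)" "1 \<le> i"
    by (auto simp: dec_primary_iff)
  \<comment> \<open>Symbols of \<open>\<theta>\<close> have primary index 1, whereas
    \<open>Suc i\<close> exceeds 1.\<close>
  then have "y \<notin> set \<theta>"
    by (auto simp: index_def primary_index_Cons_in)
  with y assms show "(i, j) \<in> index V ` (A - set \<theta>)"
    by (intro image_eqI[of _ _ y]) (auto simp: index_Cons_notin apfst_def map_prod_def split: prod.splits)
qed

lemma dec_primary_mono: "S \<subseteq> T \<Longrightarrow> dec_primary S \<subseteq> dec_primary T"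
  by (auto simp: dec_primary_def)

lemma dfv_forward: "fv s \<subseteq> symbols V \<Longrightarrow> dfv (forward V M s) \<subseteq> index V ` fv s"
proof (induction s arbitrary: V M)
  case (Lam \<theta> p s)
  then have scope: "fv s \<subseteq> set \<theta> \<union> symbols V" by auto
  then have "dfv (forward (\<theta> # V) M s) \<subseteq> index (\<theta> # V) ` fv s"
    using Lam.IH(2)[of "\<theta> # V"] by simp
  from dec_primary_mono[OF this] dec_primary_index[OF scope] Lam.IH(1)[of V] Lam.prems
  show ?case by (simp add: image_Un) blast
qed (simp_all add: index_def image_Un le_supI1 le_supI2)

lemma dfm_forward: "fm s \<subseteq> symbols M \<Longrightarrow> dfm (forward V M s) \<subseteq> index M ` fm s"
proof (induction s arbitrary: V M)
  case (Lam \<theta> p s)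
  then have scope: "fm p \<subseteq> set \<theta> \<union> symbols M" by auto
  then have "dfm (forward V (\<theta> # M) p) \<subseteq> index (\<theta> # M) ` fm p"
    using Lam.IH(1)[of "\<theta> # M"] by simp
  from dec_primary_mono[OF this] dec_primary_index[OF scope] Lam.IH(2)[of M] Lam.prems
  show ?case by (simp add: image_Un) blast
qed (simp_all add: index_def image_Un le_supI1 le_supI2)

lemma forward_defined:
  shows "fv s \<subseteq> symbols V \<Longrightarrow> \<forall>(i, j) \<in> dfv (forward V M s). entry_defined V i j"
    and "fm s \<subseteq> symbols M \<Longrightarrow> \<forall>(i, j) \<in> dfm (forward V M s). entry_defined M i j"
  using dfv_forward[of s V M] dfm_forward[of s M V] index_of_symbol(1)
  by (fastforce simp: index_def)+

text \<open>The binder bound holds because the free matchable indices of the pattern and the free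
  variable indices of the body are defined positions of a context whose first list is
  \<open>\<theta>\<close>.\<close>

lemma forward_wf:
  assumes "fv s \<subseteq> symbols V" "fm s \<subseteq> symbols M"
  shows "pos_indices (forward V M s) \<and> bounded_binders (forward V M s)"
  using assms
proof (induction s arbitrary: V M)
  case (Var y)
  then show ?case using index_of_symbol(1)[of y V] by (auto simp: entry_defined_def)
next
  case (Mat y)
  then show ?case using index_of_symbol(1)[of y M] by (auto simp: entry_defined_def)
next
  case (Lam \<theta> p s)
  then have "fm p \<subseteq> symbols (\<theta> # M)" "fv s \<subseteq> symbols (\<theta> # V)" by auto
  with Lam.IH Lam.prems forward_defined(2)[of p "\<theta> # M" V] forward_defined(1)[of s "\<theta> # V" M]
  show ?case by (auto simp: entry_defined_Cons)
qed auto

section \<open>Injectivity of the forward translation up to \<open>\<alpha>\<close>-equivalence\<close>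

abbreviation rename :: "('a \<rightharpoonup> 'a) \<Rightarrow> 'a \<Rightarrow> 'a" where
  "rename f y \<equiv> (case f y of None \<Rightarrow> y | Some z \<Rightarrow> z)"

text \<open>Index preservation survives a binder \<open>\<phi>\<close>: its symbols are exempt from
  the restricted renaming, and no other symbol is sent into \<open>\<phi>\<close> because the
  targets avoid it.\<close>

lemma index_rename_Cons:
  assumes "y \<in> set \<phi> \<union> symbols V" "ran f \<inter> set \<phi> = {}"
    and "y \<notin> set \<phi> \<Longrightarrow> rename f y \<in> symbols V' \<and> index V' (rename f y) = index V y"
  shows "rename (f |` (- set \<phi>)) y \<in> symbols (\<phi> # V') \<and>
    index (\<phi> # V') (rename (f |` (- set \<phi>)) y) = index (\<phi> # V) y"
proof (cases "y \<in> set \<phi>")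
  case True
  then show ?thesis by (simp add: index_Cons_in[of _ _ V] index_Cons_in[of _ _ V'])
next
  case False
  then have "rename f y \<notin> set \<phi>"
    using assms(2) by (auto split: option.splits simp: ran_def)
  then show ?thesis
    using False assms by (simp add: index_Cons_notin restrict_map_def)
qed

lemma ran_restrict_subset: "ran (f |` A) \<subseteq> ran f"
  by (auto simp: ran_def restrict_map_def split: if_splits)

text \<open>\<open>forward\<close> sees a free symbol only through its index, so a renaming that
  preserves indices leaves no trace. Capture is excluded because the targets do not occur in
  \<open>s\<close>, not even in binder lists.\<close>

lemma forward_ren_var:
  assumes "ran f \<inter> set_ppc s = {}"
    and "\<And>y. y \<in> fv s \<Longrightarrow>
      y \<in> symbols V \<and> rename f y \<in> symbols V' \<and> index V' (rename f y) = index V y"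
  shows "forward V' M (ren_var f s) = forward V M s"
  using assms
proof (induction s arbitrary: f V V' M)
  case (Lam \<phi> p s)
  have "forward V' (\<phi> # M) (ren_var f p) = forward V (\<phi> # M) p"
    by (rule Lam.IH(1)) (use Lam.prems in auto)
  moreover have "forward (\<phi> # V') M (ren_var (f |` (- set \<phi>)) s) = forward (\<phi> # V) M s"
  proof (rule Lam.IH(2))
    show "ran (f |` (- set \<phi>)) \<inter> set_ppc s = {}"
      using Lam.prems(1) ran_restrict_subset[of f] by fastforce
    fix y assume y: "y \<in> fv s"
    then have "y \<in> set \<phi> \<union> symbols V" using Lam.prems(2) by auto
    with index_rename_Cons[of y \<phi> V f V'] Lam.prems y
    show "y \<in> symbols (\<phi> # V) \<and> rename (f |` (- set \<phi>)) y \<in> symbols (\<phi> # V') \<and>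
        index (\<phi> # V') (rename (f |` (- set \<phi>)) y) = index (\<phi> # V) y"
      by auto
  qed
  ultimately show ?case by simp
next
  case (App s1 s2)
  have "forward V' M (ren_var f s1) = forward V M s1"
    by (rule App.IH(1)) (use App.prems in auto)
  moreover have "forward V' M (ren_var f s2) = forward V M s2"
    by (rule App.IH(2)) (use App.prems in auto)
  ultimately show ?case by simp
qed (auto simp: index_def)

text \<open>Mirror image of \<open>forward_ren_var\<close>; here the restricted renaming goes to the
  pattern.\<close>

lemma forward_ren_mat:
  assumes "ran f \<inter> set_ppc s = {}"
    and "\<And>y. y \<in> fm s \<Longrightarrow>
      y \<in> symbols M \<and> rename f y \<in> symbols M' \<and> index M' (rename f y) = index M y"
  shows "forward V M' (ren_mat f s) = forward V M s"
  using assms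
proof (induction s arbitrary: f V M M')
  case (Lam \<phi> p s)
  have "forward (\<phi> # V) M' (ren_mat f s) = forward (\<phi> # V) M s"
    by (rule Lam.IH(2)) (use Lam.prems in auto)
  moreover have "forward V (\<phi> # M') (ren_mat (f |` (- set \<phi>)) p) = forward V (\<phi> # M) p"
  proof (rule Lam.IH(1))
    show "ran (f |` (- set \<phi>)) \<inter> set_ppc p = {}"
      using Lam.prems(1) ran_restrict_subset[of f] by fastforce
    fix y assume y: "y \<in> fm p"
    then have "y \<in> set \<phi> \<union> symbols M" using Lam.prems(2) by auto
    with index_rename_Cons[of y \<phi> M f M'] Lam.prems y
    show "y \<in> symbols (\<phi> # M) \<and> rename (f |` (- set \<phi>)) y \<in> symbols (\<phi> # M') \<and>
        index (\<phi> # M') (rename (f |` (- set \<phi>)) y) = index (\<phi> # M) y"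
      by auto
  qed
  ultimately show ?case by simp
next
  case (App s1 s2)
  have "forward V M' (ren_mat f s1) = forward V M s1"
    by (rule App.IH(1)) (use App.prems in auto)
  moreover have "forward V M' (ren_mat f s2) = forward V M s2"
    by (rule App.IH(2)) (use App.prems in auto)
  ultimately show ?case by simp
qed (auto simp: index_def)

text \<open>\<open>\<theta>\<close> may contain repetitions. Both \<open>map_of\<close> and the
  minimum in \<open>secondary_index\<close> select the first occurrence of \<open>y\<close>, so
  \<open>y\<close> moves to the entry of \<open>\<theta>'\<close> at that position, and distinctness
  of \<open>\<theta>'\<close> gives this entry the same index. Freshness keeps symbols outside
  \<open>\<theta>\<close> from being shadowed.\<close>

lemma rename_zip_index:
  assumes "length \<theta>' = length \<theta>" "distinct \<theta>'" "y \<in> set \<theta> \<union> symbols V"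
    and "set \<theta>' \<inter> symbols V = {}"
  shows "rename (map_of (zip \<theta> \<theta>')) y \<in> symbols (\<theta>' # V) \<and>
    index (\<theta>' # V) (rename (map_of (zip \<theta> \<theta>')) y) = index (\<theta> # V) y"
proof (cases "y \<in> set \<theta>")
  case True
  define j where "j = secondary_index (\<theta> # V) y"
  have p: "primary_index (\<theta> # V) y = 1" using True by (rule primary_index_Cons_in)
  have "y \<in> symbols (\<theta> # V)" using True by simp
  note i = index_of_symbol[OF this]
  then have j: "1 \<le> j" "j \<le> length \<theta>" "\<theta> ! (j - 1) = y"
    unfolding p j_def[symmetric] by (auto simp: entry_defined_Cons entry_Cons)
  \<comment> \<open>By minimality of \<open>j\<close>; the offset \<open>k\<close> counts from 0 and
    belongs to secondary index \<open>Suc k\<close>.\<close>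
  have first: "\<theta> ! k \<noteq> y" if "k < j - 1" for k
  proof
    assume "\<theta> ! k = y"
    then have "j \<le> Suc k"
      unfolding j_def secondary_index_def p using that j
      by (intro Least_le) (auto simp: entry_defined_Cons entry_Cons)
    with that show False by simp
  qed
  \<comment> \<open>Splitting both lists at offset \<open>j - 1\<close> makes the lookup of
    \<open>y\<close> skip the first block and stop at the matching pair.\<close>
  have "\<theta> = take (j - 1) \<theta> @ y # drop j \<theta>"
    using id_take_nth_drop[of "j - 1" \<theta>] j by simp
  moreover have "\<theta>' = take (j - 1) \<theta>' @ \<theta>' ! (j - 1) # drop j \<theta>'"
    using id_take_nth_drop[of "j - 1" \<theta>'] j assms(1) by simp
  ultimately have "zip \<theta> \<theta>' = zip (take (j - 1) \<theta>) (take (j - 1) \<theta>') @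
      (y, \<theta>' ! (j - 1)) # zip (drop j \<theta>) (drop j \<theta>')"
    using assms(1) by (metis length_take zip_Cons_Cons zip_append)
  moreover have "map_of (zip (take (j - 1) \<theta>) (take (j - 1) \<theta>')) y = None"
    using first j assms(1) by (fastforce simp: map_of_eq_None_iff set_zip)
  ultimately have "map_of (zip \<theta> \<theta>') y = Some (\<theta>' ! (j - 1))"
    by (simp add: map_add_def)
  moreover have "index (\<theta>' # V) (\<theta>' ! (j - 1)) = (1, j)"
    using index_nth[OF assms(2), of "j - 1" V] j assms(1) by simp
  ultimately show ?thesis
    using p j assms(1) by (simp add: index_def j_def)
next
  case False
  then have "map_of (zip \<theta> \<theta>') y = None"
    using assms(1) by (auto simp: map_of_eq_None_iff set_zip)
  moreover have "y \<in> symbols V" "y \<notin> set \<theta>'"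
    using False assms by auto
  ultimately show ?thesis
    using False by (simp add: index_Cons_notin)
qed

lemma ran_zip: "length \<theta>' = length \<theta> \<Longrightarrow> ran (map_of (zip \<theta> \<theta>')) \<subseteq> set \<theta>'"
  by (auto simp: ran_def dest!: map_of_SomeD set_zip_rightD)

text \<open>The two renaming lemmas for exactly the renaming performed by
  \<open>alpha_rename\<close>.\<close>

lemma forward_rename_binders:
  assumes "length \<theta>' = length \<theta>" "distinct \<theta>'"
    and "set \<theta>' \<inter> (set_ppc (Lam \<theta> p s) \<union> symbols V \<union> symbols M) = {}"
    and "fv (Lam \<theta> p s) \<subseteq> symbols V" "fm (Lam \<theta> p s) \<subseteq> symbols M"
  shows "forward V (\<theta>' # M) (ren_mat (map_of (zip \<theta> \<theta>')) p) = forward V (\<theta> # M) p"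
    and "forward (\<theta>' # V) M (ren_var (map_of (zip \<theta> \<theta>')) s) = forward (\<theta> # V) M s"
proof -
  note ran = ran_zip[OF assms(1)]
  show "forward V (\<theta>' # M) (ren_mat (map_of (zip \<theta> \<theta>')) p) = forward V (\<theta> # M) p"
  proof (rule forward_ren_mat)
    show "ran (map_of (zip \<theta> \<theta>')) \<inter> set_ppc p = {}" using ran assms(3) by fastforce
    fix y assume "y \<in> fm p"
    with assms(5) have "y \<in> set \<theta> \<union> symbols M" by auto
    with rename_zip_index[OF assms(1,2) this] assms(3)
    show "y \<in> symbols (\<theta> # M) \<and> rename (map_of (zip \<theta> \<theta>')) y \<in> symbols (\<theta>' # M) \<and>
        index (\<theta>' # M) (rename (map_of (zip \<theta> \<theta>')) y) = index (\<theta> # M) y"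
      by auto
  qed
  show "forward (\<theta>' # V) M (ren_var (map_of (zip \<theta> \<theta>')) s) = forward (\<theta> # V) M s"
  proof (rule forward_ren_var)
    show "ran (map_of (zip \<theta> \<theta>')) \<inter> set_ppc s = {}" using ran assms(3) by fastforce
    fix y assume "y \<in> fv s"
    with assms(4) have "y \<in> set \<theta> \<union> symbols V" by auto
    with rename_zip_index[OF assms(1,2) this] assms(3)
    show "y \<in> symbols (\<theta> # V) \<and> rename (map_of (zip \<theta> \<theta>')) y \<in> symbols (\<theta>' # V) \<and>
        index (\<theta>' # V) (rename (map_of (zip \<theta> \<theta>')) y) = index (\<theta> # V) y"
      by auto
  qed
qed

section \<open>Scopes and sizes of renamed terms\<close>

lemma fv_ren_var: "fv (ren_var f s) \<subseteq> (fv s - dom f) \<union> ran f"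
proof (induction s arbitrary: f)
  case (Lam \<phi> p s)
  show ?case
    using Lam.IH(1)[of f] Lam.IH(2)[of "f |` (- set \<phi>)"] ran_restrict_subset[of f "- set \<phi>"]
    by (auto 0 3 simp: dom_def)
next
  case (App s1 s2)
  show ?case using App.IH(1)[of f] App.IH(2)[of f] by auto
qed (auto simp: ran_def split: option.splits)

lemma fm_ren_mat: "fm (ren_mat f s) \<subseteq> (fm s - dom f) \<union> ran f"
proof (induction s arbitrary: f)
  case (Lam \<phi> p s)
  show ?case
    using Lam.IH(2)[of f] Lam.IH(1)[of "f |` (- set \<phi>)"] ran_restrict_subset[of f "- set \<phi>"]
    by (auto 0 3 simp: dom_def)
next
  case (App s1 s2)
  show ?case using App.IH(1)[of f] App.IH(2)[of f] by auto
qed (auto simp: ran_def split: option.splits)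

lemma fm_ren_var [simp]: "fm (ren_var f s) = fm s"
  and fv_ren_mat [simp]: "fv (ren_mat f s) = fv s"
  by (induction s arbitrary: f) auto

text \<open>Lets an induction on the size reach renamed components.\<close>

lemma size_ren [simp]: "size (ren_var f s) = size s" "size (ren_mat f s) = size s"
  by (induction s arbitrary: f) auto

lemma finite_set_ppc [simp]: "finite (set_ppc s)"
  by (induction s) auto

text \<open>The renaming has domain \<open>set \<theta>\<close> and range within
  \<open>set \<theta>'\<close>, so it trades the binder symbols for new ones and leaves the others
  in the outer context.\<close>

lemma rename_binders_scope:
  assumes "length \<theta>' = length \<theta>" "fv (Lam \<theta> p s) \<subseteq> symbols V" "fm (Lam \<theta> p s) \<subseteq> symbols M"
  shows "fm (ren_mat (map_of (zip \<theta> \<theta>')) p) \<subseteq> symbols (\<theta>' # M)"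
    and "fv (ren_var (map_of (zip \<theta> \<theta>')) s) \<subseteq> symbols (\<theta>' # V)"
  using assms fm_ren_mat[of "map_of (zip \<theta> \<theta>')" p] fv_ren_var[of "map_of (zip \<theta> \<theta>')" s]
    ran_zip[OF assms(1)]
  by (auto 0 3)

text \<open>Induction on the size, since in the abstraction case the hypothesis is applied to
  renamed components, which are in general not subterms of \<open>s\<close>; the contexts vary
  because they grow there. At the leaves \<open>index\<close> is injective.\<close>

lemma forward_eq_imp_alpha:
  fixes s u :: "'a ppc"
  assumes inf: "infinite (UNIV :: 'a set)"
    and "fv s \<subseteq> symbols V" "fm s \<subseteq> symbols M" "fv u \<subseteq> symbols V" "fm u \<subseteq> symbols M"
    and "forward V M s = forward V M u"
  shows "s =\<^sub>\<alpha> u"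
  using assms(2-)
proof (induction "size s" arbitrary: s u V M rule: less_induct)
  case less
  show ?case
  proof (cases s)
    case (Var y)
    with less.prems obtain z where "u = Var z" by (cases u) auto
    with Var less.prems index_inject[of y V z] show ?thesis
      by (auto simp: index_def alpha_refl)
  next
    case (Mat y)
    with less.prems obtain z where "u = Mat z" by (cases u) auto
    with Mat less.prems index_inject[of y M z] show ?thesis
      by (auto simp: index_def alpha_refl)
  next
    case (App s1 s2)
    with less.prems obtain u1 u2 where u: "u = App u1 u2" by (cases u) auto
    with App less.prems less.hyps[of s1 V M u1] less.hyps[of s2 V M u2] show ?thesis
      by (auto intro: alpha_App)
  next
    case (Lam \<theta> p r)
    with less.prems obtain \<phi> q w where u: "u = Lam \<phi> q w" and len: "length \<phi> = length \<theta>"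
      by (cases u) auto
    \<comment> \<open>Common binders for both sides. Avoiding the terms serves the side condition of
      \<open>alpha_rename\<close>; avoiding the contexts prevents \<open>\<psi>\<close> from
      shadowing outer symbols.\<close>
    obtain \<psi> :: "'a list" where \<psi>: "length \<psi> = length \<theta>" "distinct \<psi>"
      and fresh: "set \<psi> \<inter> (set_ppc s \<union> set_ppc u \<union> symbols V \<union> symbols M) = {}"
      using ex_fresh_list[OF inf, of "set_ppc s \<union> set_ppc u \<union> symbols V \<union> symbols M" "length \<theta>"]
      by auto
    define f where "f = map_of (zip \<theta> \<psi>)"
    define g where "g = map_of (zip \<phi> \<psi>)"
    have \<psi>': "length \<psi> = length \<phi>" using len \<psi> by simp
    have fr: "set \<psi> \<inter> (set_ppc (Lam \<theta> p r) \<union> symbols V \<union> symbols M) = {}"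
      "set \<psi> \<inter> (set_ppc (Lam \<phi> q w) \<union> symbols V \<union> symbols M) = {}"
      using fresh Lam u by auto
    have sc: "fv (Lam \<theta> p r) \<subseteq> symbols V" "fm (Lam \<theta> p r) \<subseteq> symbols M"
      "fv (Lam \<phi> q w) \<subseteq> symbols V" "fm (Lam \<phi> q w) \<subseteq> symbols M"
      using less.prems Lam u by auto
    note fs = forward_rename_binders[OF \<psi> fr(1) sc(1,2), folded f_def]
    note fu = forward_rename_binders[OF \<psi>' \<psi>(2) fr(2) sc(3,4), folded g_def]
    note ss = rename_binders_scope[OF \<psi>(1) sc(1,2), folded f_def]
    note su = rename_binders_scope[OF \<psi>' sc(3,4), folded g_def]
    \<comment> \<open>The renamed components have the images of the original ones, which agree
      because the two abstractions have equal images.\<close>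
    have "ren_mat f p =\<^sub>\<alpha> ren_mat g q"
      by (rule less.hyps[of _ V "\<psi> # M"])
        (use Lam u sc ss su fs fu less.prems in auto)
    moreover have "ren_var f r =\<^sub>\<alpha> ren_var g w"
      by (rule less.hyps[of _ "\<psi> # V" M])
        (use Lam u sc ss su fs fu less.prems in auto)
    \<comment> \<open>The congruence rule asks for the same binder list on both sides, which
      \<open>\<psi>\<close> provides.\<close>
    ultimately have "Lam \<psi> (ren_mat f p) (ren_var f r) =\<^sub>\<alpha> Lam \<psi> (ren_mat g q) (ren_var g w)"
      by (rule alpha_Lam)
    moreover have "s =\<^sub>\<alpha> Lam \<psi> (ren_mat f p) (ren_var f r)"
      unfolding Lam f_def by (rule alpha_rename) (use \<psi> fr in auto)
    moreover have "u =\<^sub>\<alpha> Lam \<psi> (ren_mat g q) (ren_var g w)"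
      unfolding u g_def by (rule alpha_rename) (use \<psi> \<psi>' fr in auto)
    ultimately show ?thesis
      by (meson alpha_sym alpha_trans)
  qed
qed

section \<open>Initial contexts\<close>

lemma entry_defined_init_list [simp]:
  "entry_defined (init_list x n) i j \<longleftrightarrow> 1 \<le> i \<and> i \<le> n \<and> j = 1"
  by (auto simp: entry_defined_def init_list_def simp del: upt_Suc)

lemma entry_init_list [simp]: "1 \<le> i \<Longrightarrow> i \<le> n \<Longrightarrow> entry (init_list x n) i (Suc 0) = x i"
  by (auto simp: entry_def init_list_def simp del: upt_Suc)

lemma symbols_init_list [simp]: "symbols (init_list x n) = x ` {1..n}"
  by (simp add: symbols_def init_list_def image_image UNION_singleton_eq_range
      atLeastLessThanSuc_atLeastAtMost del: upt_Suc)

text \<open>The inner lists are singletons, so the secondary index is 1, and injectivity of the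
  enumeration determines the primary one.\<close>

lemma index_init_list:
  assumes "inj_on x {1..}" "1 \<le> i" "i \<le> n"
  shows "index (init_list x n) (x i) = (i, 1)"
proof -
  have "x i \<in> symbols (init_list x n)" using assms by auto
  note idx = index_of_symbol[OF this]
  then have "x (primary_index (init_list x n) (x i)) = x i" by auto
  then have "primary_index (init_list x n) (x i) = i"
    using idx(1) assms by (auto dest: inj_onD)
  with idx(1) show ?thesis by (simp add: index_def)
qed

section \<open>Existence of the top-level translations\<close>

lemma finite_free: "finite (fv s)" "finite (fm s)" "finite (dfv t)" "finite (dfm t)"
proof -
  have "finite (dec_primary S)" if "finite S" for S
    by (rule finite_subset[OF _ finite_imageI[OF that, of "apfst (\<lambda>i. i - 1)"]])
      (force simp: dec_primary_def)
  then show "finite (dfv t)" "finite (dfm t)" by (induction t) auto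
qed (induction s; auto)+

lemma translates_to_db_exists:
  assumes "bij_betw x {1..} (UNIV :: 'a set)"
  shows "\<exists>t. translates_to_db x (s :: 'a ppc) t"
proof -
  have "finite (fv s \<union> fm s)" "fv s \<union> fm s \<subseteq> x ` {1..}"
    using assms by (auto simp: finite_free bij_betw_def)
  then obtain A where A: "A \<subseteq> {1..}" "finite A" "fv s \<union> fm s = x ` A"
    by (meson finite_subset_image)
  \<comment> \<open>Inserting 0 gives a bound also for closed terms, where \<open>A\<close> is
    empty.\<close>
  then have "A \<subseteq> {1..Max (insert 0 A)}" by auto
  then show ?thesis using A(3) unfolding translates_to_db_def by blast
qed

lemma translates_to_ppc_exists:
  assumes inf: "infinite (UNIV :: 'a set)" and wf: "wf_db t"
  shows "\<exists>u. translates_to_ppc (x :: nat \<Rightarrow> 'a) t u"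
proof -
  \<comment> \<open>The largest primary index of a free index, or 0 if there is none; the context is
    then empty.\<close>
  define n where "n = Max (insert 0 (fst ` (dfv t \<union> dfm t)))"
  have "i \<le> n" if "(i, j) \<in> dfv t \<union> dfm t" for i j
    unfolding n_def using that by (intro Max_ge) (force simp: finite_free)+
  moreover have "1 \<le> i" "j = 1" if "(i, j) \<in> dfv t \<union> dfm t" for i j
    using that wf pos_indices_free[of t] by (auto simp: wf_db_def)
  ultimately have scope: "dfv t \<union> dfm t \<subseteq> {1..n} \<times> {1}"
    by (intro subrelI) simp
  have "\<exists>u. backward (init_list x n) (init_list x n) t u"
    by (rule ex_backward[OF inf]) (use wf scope in \<open>auto simp: wf_db_def bounded_binders_def\<close>)
  with scope show ?thesis by (auto simp: translates_to_ppc_def)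
qed

section \<open>The two round trips\<close>

lemma backward_init_list_free:
  assumes "dfv t \<union> dfm t \<subseteq> {1..n} \<times> {1}" "backward (init_list x n) (init_list x n) t u"
  shows "fv u = x ` {i. (i, 1) \<in> dfv t} \<and> fm u = x ` {i. (i, 1) \<in> dfm t}"
proof -
  have "(\<lambda>(i, j). entry (init_list x n) i j) ` S = x ` {i. (i, 1) \<in> S}"
    if "S \<subseteq> {1..n} \<times> {1}" for S
  proof -
    \<comment> \<open>Every secondary index in \<open>S\<close> is 1, so \<open>S\<close> is given
      by its primary indices.\<close>
    have "S = (\<lambda>i. (i, 1)) ` {i. (i, 1) \<in> S}" using that by auto
    then have "(\<lambda>(i, j). entry (init_list x n) i j) ` S =
        (\<lambda>i. entry (init_list x n) i 1) ` {i. (i, 1) \<in> S}"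
      by (metis (no_types, lifting) case_prod_conv image_cong image_image)
    also have "\<dots> = x ` {i. (i, 1) \<in> S}"
      using that by (intro image_cong) auto
    finally show ?thesis .
  qed
  with assms(1) backward_free[OF assms(2)] show ?thesis by simp
qed

text \<open>The bounds \<open>n\<close> and \<open>m\<close> of the two directions are unrelated,
  but each free symbol \<open>x i\<close> of \<open>u\<close> with \<open>i \<ge> 1\<close> has
  index \<open>(i, 1)\<close> in every initial context that contains it. The equality is therefore
  strict, without permuting secondary indices.\<close>

lemma translates_back:
  assumes "inj_on x {1..}" "translates_to_ppc x t u" "translates_to_db x u t'"
  shows "t' = t"
proof -
  from assms(2) obtain n where
    n: "dfv t \<union> dfm t \<subseteq> {1..n} \<times> {1}" "backward (init_list x n) (init_list x n) t u"
    by (auto simp: translates_to_ppc_def)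
  from assms(3) obtain m where
    m: "fv u \<union> fm u \<subseteq> x ` {1..m}" "t' = forward (init_list x m) (init_list x m) u"
    by (auto simp: translates_to_db_def)
  show ?thesis
    unfolding m(2)
  proof (rule forward_backward[OF n(2)])
    have "x i \<in> symbols (init_list x m) \<and> index (init_list x m) (x i) = (i, 1)"
      if "1 \<le> i" "x i \<in> fv u \<union> fm u" for i
    proof -
      \<comment> \<open>The scope condition only says that \<open>x i\<close> equals some
        \<open>x k\<close> with \<open>k \<le> m\<close>; injectivity turns this into
        \<open>i \<le> m\<close>.\<close>
      from m(1) that obtain k where k: "k \<in> {1..m}" "x i = x k" by auto
      with assms(1) that(1) have "i = k" by (auto dest: inj_onD)
      with k show ?thesis using index_init_list[OF assms(1)] by auto
    qed
    then have "x i \<in> symbols (init_list x m) \<and> index (init_list x m) (x i) = (i, 1)"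
      if "(i, 1) \<in> dfv t \<union> dfm t" for i
      using that n(1) backward_init_list_free[OF n] by auto
    moreover have "entry (init_list x n) i j = x i \<and> j = 1" if "(i, j) \<in> dfv t \<union> dfm t" for i j
      using that n(1) by auto
    ultimately have idx: "entry (init_list x n) i j \<in> symbols (init_list x m) \<and>
        index (init_list x m) (entry (init_list x n) i j) = (i, j)"
      if "(i, j) \<in> dfv t \<union> dfm t" for i j
      using that by metis
    show "\<forall>(i, j) \<in> dfv t. entry (init_list x n) i j \<in> symbols (init_list x m) \<and>
        index (init_list x m) (entry (init_list x n) i j) = (i, j)"
      by (clarify, rule idx, simp)
    show "\<forall>(i, j) \<in> dfm t. entry (init_list x n) i j \<in> symbols (init_list x m) \<and>
        index (init_list x m) (entry (init_list x n) i j) = (i, j)"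
      by (clarify, rule idx, simp)
  qed
qed

text \<open>Whatever bound was chosen for the backward translation, the free symbols of
  \<open>u\<close> are read off at free indices of \<open>forward X X s\<close>, and these are
  positions of \<open>X\<close>.\<close>

lemma translates_to_ppc_of_forward:
  assumes "fv s \<union> fm s \<subseteq> symbols X" "X = init_list x n"
    and "translates_to_ppc x (forward X X s) u"
  shows "fv u \<union> fm u \<subseteq> x ` {1..n}"
proof -
  from assms(3) obtain m where
    m: "dfv (forward X X s) \<union> dfm (forward X X s) \<subseteq> {1..m} \<times> {1}"
      "backward (init_list x m) (init_list x m) (forward X X s) u"
    by (auto simp: translates_to_ppc_def)
  have "i \<in> {1..n}" if "(i, 1) \<in> dfv (forward X X s) \<union> dfm (forward X X s)" for i
  proof -
    have "entry_defined X i 1"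
      using that forward_defined[of s X X] assms(1) by blast
    then show ?thesis using assms(2) by simp
  qed
  then show ?thesis unfolding backward_init_list_free[OF m, THEN conjunct1]
    backward_init_list_free[OF m, THEN conjunct2] by blast
qed

theorem theorem4p13:
  fixes x :: "nat \<Rightarrow> 'a" and t :: db and s :: "'a ppc"
  assumes enumeration: "bij_betw x {1..} (UNIV :: 'a set)"
    and wf: "wf_db t"
  shows "((\<exists>u. translates_to_ppc x t u) \<and>
          (\<forall>u. translates_to_ppc x t u \<longrightarrow>
             (\<exists>t'. translates_to_db x u t') \<and>
             (\<forall>t'. translates_to_db x u t' \<longrightarrow> t' =\<^sub>d t))) \<and>
         ((\<exists>t'. translates_to_db x s t') \<and>
          (\<forall>t'. translates_to_db x s t' \<longrightarrow>
             (\<exists>u. translates_to_ppc x t' u) \<and>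
             (\<forall>u. translates_to_ppc x t' u \<longrightarrow> u =\<^sub>\<alpha> s)))"
proof -
  have inj: "inj_on x {1..}" using enumeration by (simp add: bij_betw_def)
  have inf: "infinite (UNIV :: 'a set)"
    using bij_betw_finite[OF enumeration] infinite_Ici by blast
  have "(\<exists>u. translates_to_ppc x t' u) \<and> (\<forall>u. translates_to_ppc x t' u \<longrightarrow> u =\<^sub>\<alpha> s)"
    if "translates_to_db x s t'" for t'
  proof -
    from that obtain n where n: "fv s \<union> fm s \<subseteq> x ` {1..n}"
      and t': "t' = forward (init_list x n) (init_list x n) s"
      by (auto simp: translates_to_db_def)
    define X where "X = init_list x n"
    have scope: "fv s \<subseteq> symbols X" "fm s \<subseteq> symbols X"
      using n by (auto simp: X_def)
    \<comment> \<open>This makes a backward translation of \<open>t'\<close> available.\<close>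
    have "wf_db t'"
      unfolding wf_db_def t' X_def[symmetric]
    proof (intro conjI)
      \<comment> \<open>The lists of an initial context have length 1, which forces secondary index
        1.\<close>
      show "\<forall>(i, j) \<in> dfv (forward X X s) \<union> dfm (forward X X s). j = 1"
        using forward_defined(1)[OF scope(1), of X] forward_defined(2)[OF scope(2), of X]
        by (auto simp: X_def)
    qed (use forward_wf[OF scope] in \<open>auto simp: bounded_binders_def\<close>)
    moreover have "u =\<^sub>\<alpha> s" if u: "translates_to_ppc x t' u" for u
    proof -
      have sc: "fv u \<union> fm u \<subseteq> x ` {1..n}"
        using translates_to_ppc_of_forward[of s X x n u] scope u t' X_def by auto
      then have "translates_to_db x u (forward X X u)"
        by (auto simp: translates_to_db_def X_def)
      \<comment> \<open>\<open>translates_back\<close> with \<open>t'\<close> as the initial term: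
        translating \<open>u\<close> forward in \<open>X\<close> returns \<open>t'\<close>, the
        image of \<open>s\<close> in the same context.\<close>
      then have "forward X X u = forward X X s"
        using translates_back[OF inj u] t' X_def by simp
      then show ?thesis
        using forward_eq_imp_alpha[OF inf, of u X X s] sc scope by (auto simp: X_def)
    qed
    ultimately show ?thesis using translates_to_ppc_exists[OF inf] by blast
  qed
  moreover have "t' =\<^sub>d t" if "translates_to_ppc x t u" "translates_to_db x u t'" for u t'
    using translates_back[OF inj that] by (simp add: db_eq_refl)
  ultimately show ?thesis
    using translates_to_ppc_exists[OF inf wf] translates_to_db_exists[OF enumeration] by blast
qed

end
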